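(* For every network $G=(V,E)$ with capacities $(u_e)_{e\in E}$, source $s$, sink $t$, and every integer $\Gamma$ with $1\le\Gamma\le|E|$, one has $Z_{\mathrm{RNI}}^{\mathrm{Path}}=Z_{\mathrm{ADP}}^{\mathrm{Path}}$, that is, $$\min_{\alpha\in\Delta(\Omega)}\ \max_{x\in\mathcal X_P}\ \sum_{\mu\in\Omega}\alpha(\mu)g(\mu,x)\;=\;\max_{x\in\mathcal X_P}\ \min_{\mu\in\Omega}\ g(\mu,x).$$
   Context: $G=(V,E)$ is a finite directed graph (parallel arcs allowed) with capacities $u_e\in\mathbb R_+$ for $e\in E$, and distinct nodes $s$ (source) and $t$ (sink); no arc enters $s$ and no arc leaves $t$. $\Gamma$ is an integer with $1\le\Gamma\le|E|$. $\mathcal P$ is the set of all directed $s$-$t$-paths; $e\in P$ means arc $e$ lies on $P$. A path-based flow is $x:\mathcal P\to\mathbb R_+$ with $\sum_{P\in\mathcal P:\,e\in P}x_P\le u_e$ for all $e\in E$; $\mathcal X_P$ is the set of all path-based flows. $\Omega:=\{\mu\in\{0,1\}^{E}\mid\sum_{e\in E}\mu_e=\Gamma\}$ ($\mu_e=1$ means arc $e$ is removed). For $\mu\in\Omega$, $x\in\mathcal X_P$, the payoff is $$g(\mu,x):=\sum_{P\in\mathcal P}\max\Big\{0,\,1-\sum_{e\in P}\mu_e\Big\}\,x_P .$$ $\Delta(\Omega)$ is the set of probability distributions $\alpha:\Omega\to[0,1]$ on $\Omega$. The optimal value of the path-based randomized network interdiction problem is $Z_{\mathrm{RNI}}^{\mathrm{Path}}:=\min_{\alpha\in\Delta(\Omega)}\max_{x\in\mathcal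 X_P}\sum_{\mu\in\Omega}\alpha(\mu)g(\mu,x)$, and $Z_{\mathrm{ADP}}^{\mathrm{Path}}:=\max_{x\in\mathcal X_P}\min_{\mu\in\Omega}g(\mu,x)$. *)

theory Defs
  imports "HOL-Analysis.Analysis" "Graph_Theory.Graph_Theory"
begin

text \<open>
  A network is a multidigraph \<open>G\<close> (parallel arcs are allowed) with capacities \<open>u\<close>,
  source \<open>s\<close> and sink \<open>t\<close>.  Paths do not repeat vertices; they are given by their arc lists.
\<close>

definition st_paths :: "('a, 'b) pre_digraph \<Rightarrow> 'a \<Rightarrow> 'a \<Rightarrow> 'b list set" where
  "st_paths G s t = {p. pre_digraph.apath G s p t}"

definition path_flows ::
  "('a, 'b) pre_digraph \<Rightarrow> ('b \<Rightarrow> real) \<Rightarrow> 'a \<Rightarrow> 'a \<Rightarrow> ('b list \<Rightarrow> real) set" where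
  "path_flows G u s t = {x \<in> st_paths G s t \<rightarrow>\<^sub>E {0..}.
     \<forall>e\<in>arcs G. (\<Sum>p | p \<in> st_paths G s t \<and> e \<in> set p. x p) \<le> u e}"

definition interdictions :: "('a, 'b) pre_digraph \<Rightarrow> nat \<Rightarrow> ('b \<Rightarrow> real) set" where
  "interdictions G \<Gamma> = {\<mu> \<in> arcs G \<rightarrow>\<^sub>E {0, 1}. (\<Sum>e\<in>arcs G. \<mu> e) = real \<Gamma>}"

text \<open>Arcs of a path are pairwise distinct, so summing over \<open>set p\<close> counts each arc of \<open>p\<close> once.\<close>

definition payoff ::
  "('a, 'b) pre_digraph \<Rightarrow> 'a \<Rightarrow> 'a \<Rightarrow> ('b \<Rightarrow> real) \<Rightarrow> ('b list \<Rightarrow> real) \<Rightarrow> real" where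
  "payoff G s t \<mu> x = (\<Sum>p\<in>st_paths G s t. max 0 (1 - (\<Sum>e\<in>set p. \<mu> e)) * x p)"

definition distributions :: "'c set \<Rightarrow> ('c \<Rightarrow> real) set" where
  "distributions \<Omega> = {\<alpha> \<in> \<Omega> \<rightarrow>\<^sub>E {0..1}. (\<Sum>\<mu>\<in>\<Omega>. \<alpha> \<mu>) = 1}"

definition expected_payoff ::
  "('a, 'b) pre_digraph \<Rightarrow> 'a \<Rightarrow> 'a \<Rightarrow> nat \<Rightarrow> (('b \<Rightarrow> real) \<Rightarrow> real) \<Rightarrow> ('b list \<Rightarrow> real) \<Rightarrow> real" where
  "expected_payoff G s t \<Gamma> \<alpha> x = (\<Sum>\<mu>\<in>interdictions G \<Gamma>. \<alpha> \<mu> * payoff G s t \<mu> x)"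

text \<open>
  The optima over the infinite sets of flows and of distributions are written as \<open>SUP\<close> and \<open>INF\<close>.
  Statements that need them to be a maximum or a minimum must assert separately that they are attained.
\<close>

definition max_expected_payoff ::
  "('a, 'b) pre_digraph \<Rightarrow> ('b \<Rightarrow> real) \<Rightarrow> 'a \<Rightarrow> 'a \<Rightarrow> nat \<Rightarrow> (('b \<Rightarrow> real) \<Rightarrow> real) \<Rightarrow> real" where
  "max_expected_payoff G u s t \<Gamma> \<alpha> = (SUP x\<in>path_flows G u s t. expected_payoff G s t \<Gamma> \<alpha> x)"

definition min_payoff ::
  "('a, 'b) pre_digraph \<Rightarrow> 'a \<Rightarrow> 'a \<Rightarrow> nat \<Rightarrow> ('b list \<Rightarrow> real) \<Rightarrow> real" where
  "min_payoff G s t \<Gamma> x = (MIN \<mu>\<in>interdictions G \<Gamma>. payoff G s t \<mu> x)"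

definition Z_RNI_path ::
  "('a, 'b) pre_digraph \<Rightarrow> ('b \<Rightarrow> real) \<Rightarrow> 'a \<Rightarrow> 'a \<Rightarrow> nat \<Rightarrow> real" where
  "Z_RNI_path G u s t \<Gamma> =
     (INF \<alpha>\<in>distributions (interdictions G \<Gamma>). max_expected_payoff G u s t \<Gamma> \<alpha>)"

definition Z_ADP_path ::
  "('a, 'b) pre_digraph \<Rightarrow> ('b \<Rightarrow> real) \<Rightarrow> 'a \<Rightarrow> 'a \<Rightarrow> nat \<Rightarrow> real" where
  "Z_ADP_path G u s t \<Gamma> = (SUP x\<in>path_flows G u s t. min_payoff G s t \<Gamma> x)"

text \<open>The sums and the minimum above range over finite sets; the set of the minimum is nonempty.\<close>

lemma finite_st_paths:
  assumes "fin_digraph G"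
  shows "finite (st_paths G s t)"
  unfolding st_paths_def using assms by (rule fin_digraph.apaths_finite)

lemma finite_interdictions:
  assumes "fin_digraph G"
  shows "finite (interdictions G \<Gamma>)"
  using fin_digraph.finite_arcs[OF assms]
  by (auto simp: interdictions_def intro!: finite_PiE)

lemma interdictions_nonempty:
  assumes "fin_digraph G" and "\<Gamma> \<le> card (arcs G)"
  shows "interdictions G \<Gamma> \<noteq> {}"
proof -
  have fin: "finite (arcs G)"
    using assms(1) by (rule fin_digraph.finite_arcs)
  obtain R where R: "R \<subseteq> arcs G" "card R = \<Gamma>"
    using obtain_subset_with_card_n[OF assms(2)] by metis
  have "(\<Sum>e\<in>arcs G. if e \<in> R then 1 else 0 :: real) = real (card R)"
    using fin R(1) by (simp add: sum.If_cases Int_absorb1)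
  then have "(\<lambda>e\<in>arcs G. if e \<in> R then 1 else 0 :: real) \<in> interdictions G \<Gamma>"
    using R(2) by (auto simp: interdictions_def)
  then show ?thesis by blast
qed

end

theory Submission
  imports Defs
begin

text \<open>
  Both strategy sets are compact, and the payoff is bilinear.  Let \<open>v\<close> be the value of the
  maximin problem.  For \<open>w > v\<close>, a minimiser \<open>z\<close> over the flows of the squared total shortfall
  \<open>\<Sum>\<mu>. (max 0 (w - g \<mu> z))\<^sup>2\<close> has, by the first-order optimality condition, shortfalls that are
  proportional to a distribution against which no flow earns more than \<open>w\<close>.  Letting \<open>w\<close> decrease
  to \<open>v\<close>, compactness of the set of distributions yields a saddle point.
\<close>

section \<open>Compactness in function spaces\<close>

lemma compact_PiE_fun:
  fixes B :: "'i \<Rightarrow> ('b::topological_space) set"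
  assumes "\<And>i. i \<in> I \<Longrightarrow> compact (B i)"
  shows "compact (Pi\<^sub>E I B)"
proof -
  \<comment> \<open>Extensional functions take the single value \<open>undefined\<close> off
    \<open>I\<close>, so the set is a product over the whole index type with compact singletons as
    the remaining factors, and Tychonoff's theorem applies.\<close>
  have eq: "Pi\<^sub>E I B = Pi\<^sub>E UNIV (\<lambda>i. if i \<in> I then B i else {undefined})"
    by (force simp: PiE_iff extensional_def split: if_splits)
  have "compactin (product_topology (\<lambda>i. euclidean) UNIV)
      (Pi\<^sub>E UNIV (\<lambda>i. if i \<in> I then B i else {undefined}))"
    using assms by (subst compactin_PiE) auto
  then show ?thesis
    by (simp add: eq euclidean_product_topology)
qed

lemma compact_distributions: "compact (distributions \<Omega>)"
proof -
  have "distributions \<Omega> = (\<Omega> \<rightarrow>\<^sub>E {0..1}) \<inter> {\<alpha>. (\<Sum>\<mu>\<in>\<Omega>. \<alpha> \<mu>) = 1}"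
    by (auto simp: distributions_def)
  moreover have "closed {\<alpha>::'a \<Rightarrow> real. (\<Sum>\<mu>\<in>\<Omega>. \<alpha> \<mu>) = 1}"
    by (intro closed_Collect_eq continuous_intros continuous_on_product_coordinates)
  ultimately show ?thesis
    by (simp add: compact_Int_closed compact_PiE_fun)
qed

section \<open>Minimax for finitely many payoff functions on a compact set\<close>

lemma square_pos_part_add_le:
  fixes r h :: real
  shows "(max 0 (r + h))\<^sup>2 \<le> (max 0 r)\<^sup>2 + 2 * max 0 r * h + h\<^sup>2"
proof (cases "0 \<le> r")
  \<comment> \<open>The bound is the tangent of the squared positive part at \<open>r\<close>, plus
    the error \<open>h^2\<close>. For \<open>r \<ge> 0\<close> it equals the square of
    \<open>r + h\<close>; for \<open>r < 0\<close> it is just \<open>h^2\<close>.\<close>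
  case True
  have "(max 0 (r + h))\<^sup>2 \<le> (r + h)\<^sup>2"
    by (cases "0 \<le> r + h") auto
  with True show ?thesis
    by (simp add: power2_sum)
next
  case False
  then have "max 0 (r + h) \<le> \<bar>h\<bar>"
    by auto
  then have "(max 0 (r + h))\<^sup>2 \<le> \<bar>h\<bar>\<^sup>2"
    by (intro power_mono) auto
  with False show ?thesis
    by simp
qed

text \<open>A form of Ky Fan's convexlike condition, with equality. Only payoffs of mixtures enter
  the argument, so \<open>X\<close> needs no linear structure; one \<open>z\<close> has to serve all
  \<open>\<mu>\<close> at once.\<close>

definition convex_like :: "'c set \<Rightarrow> 'x set \<Rightarrow> ('c \<Rightarrow> 'x \<Rightarrow> real) \<Rightarrow> bool" where
  "convex_like \<Omega> X f \<longleftrightarrow> (\<forall>x\<in>X. \<forall>y\<in>X. \<forall>\<theta>\<in>{0..1}. \<exists>z\<in>X. \<forall>\<mu>\<in>\<Omega>.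
     f \<mu> z = (1 - \<theta>) * f \<mu> x + \<theta> * f \<mu> y)"

text \<open>By \<open>below\<close>, the payoff vectors miss the orthant of vectors with all entries
  at least \<open>w\<close>. The function \<open>\<phi>\<close> is the squared distance to that
  orthant, and the shortfalls at a nearest point form the normal of a separating hyperplane;
  normalised, they are \<open>\<alpha>\<close>.\<close>

lemma distribution_bounding_payoffs:
  fixes f :: "'c \<Rightarrow> 'x::topological_space \<Rightarrow> real"
  assumes fin: "finite \<Omega>" and comp: "compact X" and ne: "X \<noteq> {}"
    and cont: "\<And>\<mu>. \<mu> \<in> \<Omega> \<Longrightarrow> continuous_on X (f \<mu>)"
    and conv: "convex_like \<Omega> X f"
    and below: "\<And>x. x \<in> X \<Longrightarrow> \<exists>\<mu>\<in>\<Omega>. f \<mu> x < w"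
  shows "\<exists>\<alpha>\<in>distributions \<Omega>. \<forall>x\<in>X. (\<Sum>\<mu>\<in>\<Omega>. \<alpha> \<mu> * f \<mu> x) \<le> w"
proof -
  define \<phi> where "\<phi> x = (\<Sum>\<mu>\<in>\<Omega>. (max 0 (w - f \<mu> x))\<^sup>2)" for x
  have "continuous_on X \<phi>"
    unfolding \<phi>_def by (intro continuous_intros cont)
  then obtain x0 where x0: "x0 \<in> X" and min: "\<And>y. y \<in> X \<Longrightarrow> \<phi> x0 \<le> \<phi> y"
    using continuous_attains_inf[OF comp ne] by metis
  define b where "b \<mu> = max 0 (w - f \<mu> x0)" for \<mu>
  define B where "B = (\<Sum>\<mu>\<in>\<Omega>. b \<mu>)"
  have b_nonneg: "0 \<le> b \<mu>" for \<mu>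
    by (simp add: b_def)
  obtain \<mu>0 where "\<mu>0 \<in> \<Omega>" "0 < b \<mu>0"
    using below[OF x0] by (auto simp: b_def)
  then have B_pos: "0 < B"
    unfolding B_def using fin b_nonneg by (intro sum_pos2) auto
  \<comment> \<open>The derivative of \<open>\<phi>\<close> at \<open>x0\<close> towards
    \<open>y\<close> is -2 times this sum. Were the sum positive, a short step towards
    \<open>y\<close> would decrease \<open>\<phi>\<close>.\<close>
  have first_order: "(\<Sum>\<mu>\<in>\<Omega>. b \<mu> * (f \<mu> y - f \<mu> x0)) \<le> 0" if y: "y \<in> X" for y
  proof (rule ccontr)
    define d where "d \<mu> = f \<mu> y - f \<mu> x0" for \<mu>
    define D where "D = (\<Sum>\<mu>\<in>\<Omega>. b \<mu> * d \<mu>)"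
    define Q where "Q = (\<Sum>\<mu>\<in>\<Omega>. (d \<mu>)\<^sup>2)"
    assume "\<not> ?thesis"
    then have D_pos: "0 < D"
      by (simp add: D_def d_def)
    have Q_nonneg: "0 \<le> Q"
      by (simp add: Q_def sum_nonneg)
    \<comment> \<open>The cap 1 keeps the step a convex combination. The quotient makes the
      quadratic error at most \<open>\<theta> * D\<close>, half the linear gain;
      \<open>Q + 1\<close> avoids division by zero.\<close>
    define \<theta> where "\<theta> = min 1 (D / (Q + 1))"
    have \<theta>: "0 < \<theta>" "\<theta> \<le> 1" "\<theta> * (Q + 1) \<le> D"
    proof -
      have "\<theta> \<le> D / (Q + 1)"
        by (simp add: \<theta>_def)
      then show "\<theta> * (Q + 1) \<le> D"
        using Q_nonneg by (simp add: pos_le_divide_eq)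
    qed (use D_pos Q_nonneg in \<open>auto simp: \<theta>_def\<close>)
    then obtain z where z: "z \<in> X" and fz: "\<And>\<mu>. \<mu> \<in> \<Omega> \<Longrightarrow> f \<mu> z = (1 - \<theta>) * f \<mu> x0 + \<theta> * f \<mu> y"
      using conv x0 y unfolding convex_like_def by (metis atLeastAtMost_iff less_imp_le)
    have "\<phi> z = (\<Sum>\<mu>\<in>\<Omega>. (max 0 (w - f \<mu> x0 + - \<theta> * d \<mu>))\<^sup>2)"
      unfolding \<phi>_def by (intro sum.cong refl) (simp add: fz d_def algebra_simps)
    also have "\<dots> \<le> (\<Sum>\<mu>\<in>\<Omega>. (b \<mu>)\<^sup>2 + 2 * b \<mu> * (- \<theta> * d \<mu>) + (- \<theta> * d \<mu>)\<^sup>2)"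
      unfolding b_def by (intro sum_mono square_pos_part_add_le)
    also have "\<dots> = \<phi> x0 - 2 * \<theta> * D + \<theta>\<^sup>2 * Q"
      by (simp add: \<phi>_def b_def D_def Q_def sum.distrib sum_subtractf sum_distrib_left sum_negf
          power_mult_distrib mult_ac)
    finally have "2 * \<theta> * D \<le> \<theta>\<^sup>2 * Q"
      using min[OF z] by linarith
    then have "2 * D \<le> \<theta> * Q"
      using \<theta>(1) by (simp add: power2_eq_square mult.commute mult.left_commute)
    also have "\<dots> \<le> D"
      using \<theta> by (simp add: algebra_simps)
    finally show False
      using D_pos by simp
  qed
  define \<alpha> where "\<alpha> = (\<lambda>\<mu>\<in>\<Omega>. b \<mu> / B)"
  have "b \<mu> \<le> B" if "\<mu> \<in> \<Omega>" for \<mu>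
    unfolding B_def using that fin b_nonneg by (intro member_le_sum) auto
  then have "\<alpha> \<in> distributions \<Omega>"
    using B_pos b_nonneg
    by (auto simp: distributions_def \<alpha>_def sum_divide_distrib[symmetric] simp flip: B_def)
  moreover have "(\<Sum>\<mu>\<in>\<Omega>. \<alpha> \<mu> * f \<mu> y) \<le> w" if y: "y \<in> X" for y
  proof -
    have "(\<Sum>\<mu>\<in>\<Omega>. b \<mu> * f \<mu> y) \<le> (\<Sum>\<mu>\<in>\<Omega>. b \<mu> * f \<mu> x0)"
      using first_order[OF y] by (simp add: right_diff_distrib sum_subtractf)
    \<comment> \<open>Complementary slackness: \<open>b \<mu>\<close> vanishes wherever the payoff
      at \<open>x0\<close> exceeds \<open>w\<close>.\<close>
    also have "\<dots> \<le> (\<Sum>\<mu>\<in>\<Omega>. b \<mu> * w)"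
    proof (intro sum_mono)
      fix \<mu>
      show "b \<mu> * f \<mu> x0 \<le> b \<mu> * w"
        by (cases "f \<mu> x0 \<le> w") (simp_all add: mult_left_mono b_nonneg, simp add: b_def)
    qed
    finally have "(\<Sum>\<mu>\<in>\<Omega>. b \<mu> * f \<mu> y) / B \<le> w"
      using B_pos by (simp add: B_def pos_divide_le_eq mult.commute flip: sum_distrib_left)
    then show ?thesis
      by (simp add: \<alpha>_def sum_divide_distrib)
  qed
  ultimately show ?thesis
    by blast
qed

text \<open>The separation argument needs strict inequality and fails at the maximin value itself,
  so that value is approached from above. Optimal strategies are obtained along with
  \<open>v\<close> because attainment is claimed on both sides.\<close>

lemma minimax_saddle_point:
  fixes f :: "'c \<Rightarrow> 'x::topological_space \<Rightarrow> real"
  assumes fin: "finite \<Omega>" and \<Omega>_ne: "\<Omega> \<noteq> {}" and comp: "compact X" and ne: "X \<noteq> {}"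
    and cont: "\<And>\<mu>. \<mu> \<in> \<Omega> \<Longrightarrow> continuous_on X (f \<mu>)"
    and conv: "convex_like \<Omega> X f"
  obtains \<alpha> x v where "\<alpha> \<in> distributions \<Omega>" "x \<in> X"
    "\<forall>y\<in>X. (\<Sum>\<mu>\<in>\<Omega>. \<alpha> \<mu> * f \<mu> y) \<le> v"
    "\<forall>\<mu>\<in>\<Omega>. v \<le> f \<mu> x"
    "\<forall>y\<in>X. \<exists>\<mu>\<in>\<Omega>. f \<mu> y \<le> v"
proof -
  define m where "m x = (MIN \<mu>\<in>\<Omega>. f \<mu> x)" for x
  have m_le: "m x \<le> f \<mu> x" if "\<mu> \<in> \<Omega>" for \<mu> x
    unfolding m_def using fin that by simp
  have m_attained: "\<exists>\<mu>\<in>\<Omega>. f \<mu> x = m x" for x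
    unfolding m_def using Min_in[of "(\<lambda>\<mu>. f \<mu> x) ` \<Omega>"] fin \<Omega>_ne by fastforce
  have "continuous_on X m"
    unfolding m_def using fin \<Omega>_ne cont
  proof (induction \<Omega> rule: finite_ne_induct)
    case (singleton \<mu>)
    then show ?case by simp
  next
    case (insert \<mu> F)
    then have "continuous_on X (\<lambda>x. min (f \<mu> x) (MIN \<mu>\<in>F. f \<mu> x))"
      by (intro continuous_on_min) auto
    with insert show ?case by simp
  qed
  then obtain x where x: "x \<in> X" and max: "\<And>y. y \<in> X \<Longrightarrow> m y \<le> m x"
    using continuous_attains_sup[OF comp ne] by metis
  \<comment> \<open>Each \<open>K w\<close> is an intersection of closed half-spaces and grows with
    \<open>w\<close>, which suits the finite intersection property.\<close>
  define K where "K w = {\<alpha>. \<forall>y\<in>X. (\<Sum>\<mu>\<in>\<Omega>. \<alpha> \<mu> * f \<mu> y) \<le> w}" for w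
  have closed_K: "closed (K w)" for w
  proof -
    have "K w = (\<Inter>y\<in>X. {\<alpha>. (\<Sum>\<mu>\<in>\<Omega>. \<alpha> \<mu> * f \<mu> y) \<le> w})"
      by (auto simp: K_def)
    moreover have "closed \<dots>"
      by (intro closed_INT ballI closed_Collect_le continuous_intros continuous_on_product_coordinates)
    ultimately show ?thesis
      by simp
  qed
  have K_ne: "distributions \<Omega> \<inter> K w \<noteq> {}" if "m x < w" for w
  proof -
    have "\<exists>\<mu>\<in>\<Omega>. f \<mu> y < w" if "y \<in> X" for y
      using m_attained[of y] max[OF that] \<open>m x < w\<close> by force
    from distribution_bounding_payoffs[OF fin comp ne cont conv this] show ?thesis
      by (auto simp: K_def)
  qed
  have "distributions \<Omega> \<inter> (\<Inter>w\<in>{m x<..}. K w) \<noteq> {}"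
  proof (rule compact_imp_fip_image[OF compact_distributions closed_K])
    fix W
    assume W: "finite W" "W \<subseteq> {m x<..}"
    \<comment> \<open>The additional element \<open>m x + 1\<close> covers empty \<open>W\<close>
      and keeps the minimum above \<open>m x\<close>.\<close>
    define w where "w = Min (insert (m x + 1) W)"
    have "m x < w"
      using W by (auto simp: w_def)
    moreover have "K w \<subseteq> K w'" if "w' \<in> W" for w'
    proof -
      have "w \<le> w'"
        using W that by (simp add: w_def)
      then show ?thesis
        by (force simp: K_def)
    qed
    ultimately show "distributions \<Omega> \<inter> (\<Inter>w\<in>W. K w) \<noteq> {}"
      using K_ne[of w] by blast
  qed
  then obtain \<alpha> where \<alpha>: "\<alpha> \<in> distributions \<Omega>" "\<And>w. m x < w \<Longrightarrow> \<alpha> \<in> K w"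
    by auto
  have "(\<Sum>\<mu>\<in>\<Omega>. \<alpha> \<mu> * f \<mu> y) \<le> m x" if "y \<in> X" for y
    by (rule dense_ge) (use \<alpha>(2) that in \<open>auto simp: K_def\<close>)
  moreover have "\<exists>\<mu>\<in>\<Omega>. f \<mu> y \<le> m x" if "y \<in> X" for y
    using m_attained[of y] max[OF that] by force
  ultimately show thesis
    using that \<alpha>(1) x m_le by blast
qed

section \<open>Compactness and convexity of the set of path flows\<close>

lemma st_path_has_arc:
  assumes "fin_digraph G" "s \<noteq> t" "p \<in> st_paths G s t"
  obtains e where "e \<in> set p" "e \<in> arcs G"
proof -
  interpret fin_digraph G by fact
  have "awalk s p t"
    using assms(3) by (auto simp: st_paths_def apath_def)
  then have "p \<noteq> []" "set p \<subseteq> arcs G"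
    using assms(2) by (auto simp: awalk_def)
  then show thesis
    using that by (cases p) auto
qed

text \<open>Since \<open>s \<noteq> t\<close>, every path has an arc, whose capacity bounds the flow
  on the path. For \<open>s = t\<close> the empty path could carry unbounded flow.\<close>

lemma compact_path_flows:
  assumes fin: "fin_digraph G" and "s \<noteq> t"
  shows "compact (path_flows G u s t)"
proof -
  let ?P = "st_paths G s t"
  define M where "M = (\<Sum>e\<in>arcs G. \<bar>u e\<bar>)"
  define C where "C e = {x. (\<Sum>p | p \<in> ?P \<and> e \<in> set p. x p) \<le> u e}" for e
  have bound: "x p \<le> M" if x: "x \<in> path_flows G u s t" and p: "p \<in> ?P" for x p
  proof -
    obtain e where e: "e \<in> set p" "e \<in> arcs G"
      using st_path_has_arc[OF fin \<open>s \<noteq> t\<close> p] .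
    have "x p \<le> (\<Sum>q | q \<in> ?P \<and> e \<in> set q. x q)"
      using x p e finite_st_paths[OF fin]
      by (intro member_le_sum) (auto simp: path_flows_def)
    also have "\<dots> \<le> \<bar>u e\<bar>"
      using x e(2) by (force simp: path_flows_def)
    also have "\<dots> \<le> M"
      unfolding M_def using e(2) fin_digraph.finite_arcs[OF fin] by (intro member_le_sum) auto
    finally show ?thesis .
  qed
  \<comment> \<open>The bound replaces the half-lines by compact intervals without changing the set,
    leaving a closed part of a compact box.\<close>
  have "path_flows G u s t = (?P \<rightarrow>\<^sub>E {0..M}) \<inter> (\<Inter>e\<in>arcs G. C e)"
  proof (intro set_eqI iffI)
    fix x
    assume x: "x \<in> path_flows G u s t"
    then show "x \<in> (?P \<rightarrow>\<^sub>E {0..M}) \<inter> (\<Inter>e\<in>arcs G. C e)"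
      using bound[OF x] by (auto simp: path_flows_def C_def PiE_iff)
  qed (auto simp: path_flows_def C_def PiE_iff)
  moreover have "closed (C e)" for e
    unfolding C_def
    by (intro closed_Collect_le continuous_intros continuous_on_product_coordinates)
  ultimately show ?thesis
    by (simp add: compact_Int_closed compact_PiE_fun closed_INT)
qed

lemma path_flows_nonempty:
  assumes "\<And>e. e \<in> arcs G \<Longrightarrow> 0 \<le> u e"
  shows "path_flows G u s t \<noteq> {}"
proof -
  have "(\<lambda>p\<in>st_paths G s t. 0) \<in> path_flows G u s t"
    using assms by (auto simp: path_flows_def)
  then show ?thesis
    by blast
qed

text \<open>For fixed \<open>\<mu>\<close> the coefficient of \<open>x p\<close> does not depend on
  the flow, so the payoff is linear in \<open>x\<close> and the pointwise mixture works for every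
  \<open>\<mu>\<close>.\<close>

lemma convex_like_payoff: "convex_like \<Omega> (path_flows G u s t) (payoff G s t)"
  unfolding convex_like_def
proof (intro ballI)
  let ?P = "st_paths G s t"
  fix x y and \<theta> :: real
  assume x: "x \<in> path_flows G u s t" and y: "y \<in> path_flows G u s t" and \<theta>: "\<theta> \<in> {0..1}"
  \<comment> \<open>The restriction to paths keeps \<open>z\<close> extensional, as membership in
    \<open>path_flows\<close> demands.\<close>
  define z where "z = (\<lambda>p\<in>?P. (1 - \<theta>) * x p + \<theta> * y p)"
  have "(\<Sum>p | p \<in> ?P \<and> e \<in> set p. z p) \<le> u e" if "e \<in> arcs G" for e
  proof -
    have "(\<Sum>p | p \<in> ?P \<and> e \<in> set p. z p) =
        (1 - \<theta>) * (\<Sum>p | p \<in> ?P \<and> e \<in> set p. x p) + \<theta> * (\<Sum>p | p \<in> ?P \<and> e \<in> set p. y p)"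
      by (simp add: z_def sum.distrib sum_distrib_left)
    also have "\<dots> \<le> u e"
      using x y that \<theta> by (intro convex_bound_le) (auto simp: path_flows_def)
    finally show ?thesis .
  qed
  then have "z \<in> path_flows G u s t"
    using x y \<theta> by (auto simp: path_flows_def z_def PiE_iff)
  moreover have "payoff G s t \<mu> z = (1 - \<theta>) * payoff G s t \<mu> x + \<theta> * payoff G s t \<mu> y" for \<mu>
    unfolding payoff_def sum_distrib_left sum.distrib[symmetric]
    by (intro sum.cong refl) (simp add: z_def algebra_simps)
  ultimately show "\<exists>z\<in>path_flows G u s t. \<forall>\<mu>\<in>\<Omega>.
      payoff G s t \<mu> z = (1 - \<theta>) * payoff G s t \<mu> x + \<theta> * payoff G s t \<mu> y"
    by blast
qed

lemma continuous_on_payoff: "continuous_on X (payoff G s t \<mu>)"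
  unfolding payoff_def
  by (intro continuous_intros continuous_on_subset[OF continuous_on_product_coordinates]) auto

section \<open>Attainment and equality of the two values\<close>

lemma expected_value_ge:
  assumes "\<alpha> \<in> distributions \<Omega>" and "\<forall>\<mu>\<in>\<Omega>. v \<le> g \<mu>"
  shows "v \<le> (\<Sum>\<mu>\<in>\<Omega>. \<alpha> \<mu> * g \<mu>)"
proof -
  have "v = (\<Sum>\<mu>\<in>\<Omega>. \<alpha> \<mu> * v)"
    using assms(1) by (simp add: distributions_def flip: sum_distrib_right)
  also have "\<dots> \<le> (\<Sum>\<mu>\<in>\<Omega>. \<alpha> \<mu> * g \<mu>)"
    using assms by (intro sum_mono mult_left_mono) (auto simp: distributions_def PiE_iff)
  finally show ?thesis .
qed

theorem theorem2:
  fixes G :: "('a, 'b) pre_digraph" and u :: "'b \<Rightarrow> real" and s t :: 'a and \<Gamma> :: nat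
  assumes "fin_digraph G"
    and "s \<in> verts G" and "t \<in> verts G" and "s \<noteq> t"
    and "\<And>e. e \<in> arcs G \<Longrightarrow> head G e \<noteq> s"
    and "\<And>e. e \<in> arcs G \<Longrightarrow> tail G e \<noteq> t"
    and "\<And>e. e \<in> arcs G \<Longrightarrow> 0 \<le> u e"
    and "1 \<le> \<Gamma>" and "\<Gamma> \<le> card (arcs G)"
  shows "(\<forall>\<alpha>\<in>distributions (interdictions G \<Gamma>).
            \<exists>x. is_arg_max (expected_payoff G s t \<Gamma> \<alpha>) (\<lambda>x. x \<in> path_flows G u s t) x)
       \<and> (\<exists>\<alpha>. is_arg_min (max_expected_payoff G u s t \<Gamma>)
                 (\<lambda>\<alpha>. \<alpha> \<in> distributions (interdictions G \<Gamma>)) \<alpha>)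
       \<and> (\<exists>x. is_arg_max (min_payoff G s t \<Gamma>) (\<lambda>x. x \<in> path_flows G u s t) x)
       \<and> Z_RNI_path G u s t \<Gamma> = Z_ADP_path G u s t \<Gamma>"
proof -
  let ?\<Omega> = "interdictions G \<Gamma>" and ?X = "path_flows G u s t"
  let ?E = "expected_payoff G s t \<Gamma>" and ?F = "max_expected_payoff G u s t \<Gamma>"
    and ?m = "min_payoff G s t \<Gamma>"
  have fin: "finite ?\<Omega>" and \<Omega>_ne: "?\<Omega> \<noteq> {}"
    using finite_interdictions[OF assms(1)] interdictions_nonempty[OF assms(1,9)] .
  have comp: "compact ?X" and ne: "?X \<noteq> {}"
    using compact_path_flows[OF assms(1,4)] path_flows_nonempty[OF assms(7)] .
  obtain \<alpha> x v where \<alpha>: "\<alpha> \<in> distributions ?\<Omega>" and x: "x \<in> ?X"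
    and upper: "\<forall>y\<in>?X. (\<Sum>\<mu>\<in>?\<Omega>. \<alpha> \<mu> * payoff G s t \<mu> y) \<le> v"
    and lower: "\<forall>\<mu>\<in>?\<Omega>. v \<le> payoff G s t \<mu> x"
    and val: "\<forall>y\<in>?X. \<exists>\<mu>\<in>?\<Omega>. payoff G s t \<mu> y \<le> v"
    using minimax_saddle_point[OF fin \<Omega>_ne comp ne continuous_on_payoff convex_like_payoff] .
  \<comment> \<open>Besides giving the inner maximum, attainment supplies the upper bound that makes
    the real-valued \<open>SUP\<close> meaningful.\<close>
  have max: "\<exists>y\<in>?X. \<forall>z\<in>?X. ?E \<beta> z \<le> ?E \<beta> y" for \<beta>
    unfolding expected_payoff_def
    by (intro continuous_attains_sup comp ne continuous_intros continuous_on_payoff)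
  have E_le_F: "?E \<beta> y \<le> ?F \<beta>" if "y \<in> ?X" for \<beta> y
    unfolding max_expected_payoff_def using that
  proof (rule cSUP_upper)
    show "bdd_above (?E \<beta> ` ?X)"
      using max[of \<beta>] by (auto simp: bdd_above_def)
  qed
  \<comment> \<open>Weak duality: the flow \<open>x\<close> earns at least \<open>v\<close> against
    each pure interdiction, hence on average.\<close>
  have F_ge: "v \<le> ?F \<beta>" if "\<beta> \<in> distributions ?\<Omega>" for \<beta>
    using expected_value_ge[OF that lower] E_le_F[OF x, of \<beta>]
    by (simp add: expected_payoff_def)
  have F_\<alpha>: "?F \<alpha> = v"
  proof (rule antisym)
    show "?F \<alpha> \<le> v"
      unfolding max_expected_payoff_def expected_payoff_def
      using upper by (intro cSUP_least ne) auto
  qed (rule F_ge[OF \<alpha>])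
  have m_le: "?m y \<le> v" if "y \<in> ?X" for y
    unfolding min_payoff_def using bspec[OF val that] fin \<Omega>_ne by (auto simp: Min_le_iff)
  have "v \<le> ?m x"
    unfolding min_payoff_def using lower fin \<Omega>_ne by simp
  then have m_x: "?m x = v"
    using m_le[OF x] by simp
  have "Z_RNI_path G u s t \<Gamma> = v"
    unfolding Z_RNI_path_def using F_\<alpha> F_ge \<alpha> by (intro cInf_eq_minimum) auto
  moreover have "Z_ADP_path G u s t \<Gamma> = v"
    unfolding Z_ADP_path_def using m_x m_le x by (intro cSup_eq_maximum) auto
  moreover have "\<exists>y. is_arg_max (?E \<beta>) (\<lambda>x. x \<in> ?X) y" for \<beta>
    using max[of \<beta>] by (auto simp: is_arg_max_def not_less)
  moreover have "is_arg_min ?F (\<lambda>\<alpha>. \<alpha> \<in> distributions ?\<Omega>) \<alpha>"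
    using \<alpha> F_\<alpha> F_ge by (auto simp: is_arg_min_linorder)
  moreover have "is_arg_max ?m (\<lambda>x. x \<in> ?X) x"
    using x m_x m_le by (auto simp: is_arg_max_def not_less)
  ultimately show ?thesis
    by auto
qed

end
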